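(* Let $P$ be a dcpo and $A \subseteq P$. Then $A \in \overline{\Gamma_{c}(P)}$ if and only if $A$ is Scott closed and $\bigvee$-existing; that is, $\overline{\Gamma_{c}(P)} = P^{\vee}$, where $P^{\vee}$ denotes the set of all $\bigvee$-existing Scott closed subsets of $P$.
   Context: A subset $S$ of a poset is consistent if it has an upper bound. A dcpo-$\vee_{\uparrow}$-semilattice is a dcpo $L$ in which every consistent pair $x,y$ (i.e., $x,y$ have a common upper bound) has a join $x\vee y$ in $L$. A subset $A$ of a dcpo $P$ is Scott closed if it is a lower set closed under suprema of directed subsets. $\Gamma(P)$ denotes the set of all nonempty Scott closed subsets of $P$, ordered by inclusion (a dcpo, in which the supremum of a directed family is the Scott closure of its union), and $\Gamma_{c}(P)$ denotes the set of all nonempty, consistent, Scott closed subsets of $P$. $\overline{\Gamma_{c}(P)}$ is the closure of $\Gamma_{c}(P)$ in the Scott topology of $\Gamma(P)$. A subset $A$ of a dcpo $P$ is called $\bigvee$-existing if for every Scott continuous function $f : P \to L$ into any dcpo-$\vee_{\uparrow}$-semilattice $L$, the supremum $\bigvee f(A)$ exists in $L$. *)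

theory Defs
  imports "HOL-Algebra.Order" "HOL-Analysis.Abstract_Topology"
begin

text \<open>
  Posets are \<^typ>\<open>'a gorder\<close> structures satisfying \<^locale>\<open>partial_order\<close>; the supremum of a set
  is expressed by the abbreviation \<open>is_lub\<close>, i.e. \<open>is_lub L s S\<close> says that the supremum of \<open>S\<close>
  in \<open>L\<close> exists and is \<open>s\<close>.
\<close>

\<comment> \<open>frees the infix \<open>closure_of\<close> for the closure in a topology\<close>
no_notation eq_closure_of (\<open>closure'_of\<index>\<close>)

definition directed_in :: "'a gorder \<Rightarrow> 'a set \<Rightarrow> bool" where
  "directed_in P D \<longleftrightarrow> D \<subseteq> carrier P \<and> D \<noteq> {} \<and>
     (\<forall>x\<in>D. \<forall>y\<in>D. \<exists>z\<in>D. x \<sqsubseteq>\<^bsub>P\<^esub> z \<and> y \<sqsubseteq>\<^bsub>P\<^esub> z)"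

definition dcpo :: "'a gorder \<Rightarrow> bool" where
  "dcpo P \<longleftrightarrow> partial_order P \<and> (\<forall>D. directed_in P D \<longrightarrow> (\<exists>s. is_lub P s D))"

definition consistent :: "'a gorder \<Rightarrow> 'a set \<Rightarrow> bool" where
  "consistent P S \<longleftrightarrow> S \<subseteq> carrier P \<and> Upper P S \<noteq> {}"

definition dcpo_vee_semilattice :: "'a gorder \<Rightarrow> bool" where
  "dcpo_vee_semilattice L \<longleftrightarrow> dcpo L \<and>
     (\<forall>x\<in>carrier L. \<forall>y\<in>carrier L. consistent L {x, y} \<longrightarrow> (\<exists>j. is_lub L j {x, y}))"

definition scott_closed :: "'a gorder \<Rightarrow> 'a set \<Rightarrow> bool" where
  "scott_closed P A \<longleftrightarrow> A \<subseteq> carrier P \<and>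
     (\<forall>x\<in>A. \<forall>y\<in>carrier P. y \<sqsubseteq>\<^bsub>P\<^esub> x \<longrightarrow> y \<in> A) \<and>
     (\<forall>D s. directed_in P D \<and> D \<subseteq> A \<and> is_lub P s D \<longrightarrow> s \<in> A)"

definition scott_topology :: "'a gorder \<Rightarrow> 'a topology" where
  "scott_topology P = topology (\<lambda>U. U \<subseteq> carrier P \<and> scott_closed P (carrier P - U))"

definition scott_continuous :: "'a gorder \<Rightarrow> 'b gorder \<Rightarrow> ('a \<Rightarrow> 'b) \<Rightarrow> bool" where
  "scott_continuous P L f \<longleftrightarrow> continuous_map (scott_topology P) (scott_topology L) f"

definition Gamma :: "'a gorder \<Rightarrow> 'a set gorder" where
  "Gamma P = \<lparr>carrier = {A. scott_closed P A \<and> A \<noteq> {}}, eq = (=), le = (\<subseteq>)\<rparr>"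

definition Gamma_c :: "'a gorder \<Rightarrow> 'a set set" where
  "Gamma_c P = {A \<in> carrier (Gamma P). consistent P A}"

text \<open>
  HOL cannot quantify over types inside a formula, so the type \<^typ>\<open>'b\<close> carrying the test
  semilattices \<open>L\<close> is a parameter; \<open>L\<close> ranges over all structures on all subsets of \<^typ>\<open>'b\<close>.
\<close>

definition vee_existing :: "'b itself \<Rightarrow> 'a gorder \<Rightarrow> 'a set \<Rightarrow> bool" where
  "vee_existing _ P A \<longleftrightarrow> A \<subseteq> carrier P \<and>
     (\<forall>(L :: 'b gorder) f. dcpo_vee_semilattice L \<and> scott_continuous P L f \<longrightarrow>
        (\<exists>s. is_lub L s (f ` A)))"

definition vee_completion :: "'b itself \<Rightarrow> 'a gorder \<Rightarrow> 'a set set" where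
  "vee_completion T P = {A. scott_closed P A \<and> vee_existing T P A}"

lemma scott_closed_Un:
  assumes "scott_closed P A" "scott_closed P B"
  shows "scott_closed P (A \<union> B)"
proof -
  have split: "D \<subseteq> A \<or> D \<subseteq> B" if D: "directed_in P D" "D \<subseteq> A \<union> B" for D
  proof (rule ccontr)
    assume "\<not> (D \<subseteq> A \<or> D \<subseteq> B)"
    then obtain x y where xy: "x \<in> D" "x \<notin> A" "y \<in> D" "y \<notin> B" by blast
    then obtain z where z: "z \<in> D" "x \<sqsubseteq>\<^bsub>P\<^esub> z" "y \<sqsubseteq>\<^bsub>P\<^esub> z"
      using D(1) unfolding directed_in_def by blast
    have "x \<in> carrier P" "y \<in> carrier P" using D(1) xy unfolding directed_in_def by auto
    then have "z \<notin> A" "z \<notin> B" using assms xy z unfolding scott_closed_def by metis+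
    then show False using z(1) D(2) by blast
  qed
  show ?thesis
    unfolding scott_closed_def
  proof (intro conjI ballI allI impI)
    show "A \<union> B \<subseteq> carrier P" using assms by (simp add: scott_closed_def)
  next
    fix x y assume "x \<in> A \<union> B" "y \<in> carrier P" "y \<sqsubseteq>\<^bsub>P\<^esub> x"
    then show "y \<in> A \<union> B" using assms unfolding scott_closed_def by (metis Un_iff)
  next
    fix D s assume D: "directed_in P D \<and> D \<subseteq> A \<union> B \<and> is_lub P s D"
    then have "D \<subseteq> A \<or> D \<subseteq> B" using split by blast
    then show "s \<in> A \<union> B"
    proof
      assume "D \<subseteq> A"
      then have "s \<in> A" using D assms(1) unfolding scott_closed_def by metis
      then show ?thesis by blast
    next
      assume "D \<subseteq> B"
      then have "s \<in> B" using D assms(2) unfolding scott_closed_def by metis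
      then show ?thesis by blast
    qed
  qed
qed

lemma istopology_scott:
  "istopology (\<lambda>U. U \<subseteq> carrier P \<and> scott_closed P (carrier P - U))"
  unfolding istopology_def
proof (intro conjI allI impI)
  fix S T assume "S \<subseteq> carrier P \<and> scott_closed P (carrier P - S)"
    and "T \<subseteq> carrier P \<and> scott_closed P (carrier P - T)"
  then show "S \<inter> T \<subseteq> carrier P" "scott_closed P (carrier P - S \<inter> T)"
    using scott_closed_Un[of P "carrier P - S" "carrier P - T"] by (simp_all add: Diff_Int le_infI1)
next
  fix K assume K: "\<forall>U\<in>K. U \<subseteq> carrier P \<and> scott_closed P (carrier P - U)"
  then show "\<Union>K \<subseteq> carrier P" by blast
  show "scott_closed P (carrier P - \<Union>K)"
    unfolding scott_closed_def
  proof (intro conjI ballI allI impI)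
    show "carrier P - \<Union>K \<subseteq> carrier P" by blast
  next
    fix x y assume "x \<in> carrier P - \<Union>K" "y \<in> carrier P" "y \<sqsubseteq>\<^bsub>P\<^esub> x"
    then show "y \<in> carrier P - \<Union>K" using K unfolding scott_closed_def by blast
  next
    fix D s assume D: "directed_in P D \<and> D \<subseteq> carrier P - \<Union>K \<and> is_lub P s D"
    then have "s \<in> carrier P" unfolding least_def by blast
    moreover have "s \<notin> U" if "U \<in> K" for U
    proof -
      have "D \<subseteq> carrier P - U" using D that by blast
      then show ?thesis using K that D unfolding scott_closed_def by blast
    qed
    ultimately show "s \<in> carrier P - \<Union>K" by blast
  qed
qed

lemma openin_scott_topology:
  shows "openin (scott_topology P) U \<longleftrightarrow> U \<subseteq> carrier P \<and> scott_closed P (carrier P - U)"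
  unfolding scott_topology_def topology_inverse'[OF istopology_scott] by (rule refl)

lemma topspace_scott_topology:
  shows "topspace (scott_topology P) = carrier P"
proof -
  have "scott_closed P {}" by (auto simp: scott_closed_def directed_in_def)
  then have "openin (scott_topology P) (carrier P)"
    by (simp add: openin_scott_topology)
  then have "carrier P \<subseteq> topspace (scott_topology P)" by (rule openin_subset)
  moreover have "topspace (scott_topology P) \<subseteq> carrier P"
    using openin_topspace[of "scott_topology P"] by (simp only: openin_scott_topology)
  ultimately show ?thesis by blast
qed

lemma closedin_scott_topology:
  shows "closedin (scott_topology P) A \<longleftrightarrow> scott_closed P A"
proof -
  have "carrier P - (carrier P - A) = A" if "A \<subseteq> carrier P" using that by blast
  moreover have "A \<subseteq> carrier P" if "scott_closed P A" using that by (simp add: scott_closed_def)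
  ultimately show ?thesis
    unfolding closedin_def openin_scott_topology topspace_scott_topology
    by (metis Diff_subset)
qed

lemma partial_order_Gamma: "partial_order (Gamma P)"
  by unfold_locales (simp_all add: Gamma_def)

end

theory Submission
  imports Defs
begin

text \<open>
  For a Scott continuous \<open>f\<close> into a dcpo-\<open>\<or>\<up>\<close>-semilattice \<open>L\<close>, the sets \<open>A \<in> \<Gamma>(P)\<close> for which
  \<open>f(A)\<close> has a supremum form a Scott closed subset of \<open>\<Gamma>(P)\<close> containing \<open>\<Gamma>\<^sub>c(P)\<close>; the key fact is that
  every nonempty bounded subset of \<open>L\<close> has a supremum.  Hence the closure of \<open>\<Gamma>\<^sub>c(P)\<close> consists of
  \<open>\<Or>\<close>-existing sets.  Conversely the closure is, as a Scott closed subset of \<open>\<Gamma>(P)\<close>, itself a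
  dcpo-\<open>\<or>\<up>\<close>-semilattice, and \<open>x \<mapsto> \<down>x\<close> is Scott continuous into it; a supremum of the image of \<open>A\<close>
  is a member of the closure that contains \<open>A\<close>, and the closure is a lower set.
\<close>

section \<open>Suprema, principal ideals and monotonicity of Scott continuous maps\<close>

lemma is_lub_iff:
  assumes "S \<subseteq> carrier L"
  shows "is_lub L s S \<longleftrightarrow> s \<in> carrier L \<and> (\<forall>x\<in>S. x \<sqsubseteq>\<^bsub>L\<^esub> s) \<and>
           (\<forall>u\<in>carrier L. (\<forall>x\<in>S. x \<sqsubseteq>\<^bsub>L\<^esub> u) \<longrightarrow> s \<sqsubseteq>\<^bsub>L\<^esub> u)"
  using assms unfolding least_def Upper_def by blast

lemma partial_order_refl: "partial_order L \<Longrightarrow> x \<in> carrier L \<Longrightarrow> x \<sqsubseteq>\<^bsub>L\<^esub> x"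
  by (simp add: partial_order_def weak_partial_order.le_refl)

lemma partial_order_trans:
  assumes "partial_order L" "x \<sqsubseteq>\<^bsub>L\<^esub> y" "y \<sqsubseteq>\<^bsub>L\<^esub> z"
    "x \<in> carrier L" "y \<in> carrier L" "z \<in> carrier L"
  shows "x \<sqsubseteq>\<^bsub>L\<^esub> z"
  using assms weak_partial_order.le_trans unfolding partial_order_def by metis

lemma consistent_iff:
  "consistent L S \<longleftrightarrow> S \<subseteq> carrier L \<and> (\<exists>u\<in>carrier L. \<forall>x\<in>S. x \<sqsubseteq>\<^bsub>L\<^esub> u)"
  unfolding consistent_def Upper_def by blast

text \<open>Transitivity makes the principal ideal a lower set, and \<open>y\<close>, being an upper
  bound of \<open>D\<close>, lies above the least one. These sets serve both as members of
  \<Gamma>(P) and as closed sets of \<open>L\<close> whose preimages express bounds on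
  \<open>f\<close>.\<close>

lemma scott_closed_principal:
  assumes L: "partial_order L" and y: "y \<in> carrier L"
  shows "scott_closed L {x \<in> carrier L. x \<sqsubseteq>\<^bsub>L\<^esub> y}"
  unfolding scott_closed_def
proof (intro conjI ballI allI impI)
  fix x z assume "x \<in> {x \<in> carrier L. x \<sqsubseteq>\<^bsub>L\<^esub> y}" "z \<in> carrier L" "z \<sqsubseteq>\<^bsub>L\<^esub> x"
  then show "z \<in> {x \<in> carrier L. x \<sqsubseteq>\<^bsub>L\<^esub> y}"
    using partial_order_trans[OF L] y by blast
next
  fix D s
  assume D: "directed_in L D \<and> D \<subseteq> {x \<in> carrier L. x \<sqsubseteq>\<^bsub>L\<^esub> y} \<and> is_lub L s D"
  then have "D \<subseteq> carrier L" by blast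
  then show "s \<in> {x \<in> carrier L. x \<sqsubseteq>\<^bsub>L\<^esub> y}"
    using D y is_lub_iff[of D L s] by blast
qed blast

lemma scott_continuous_iff:
  "scott_continuous P L f \<longleftrightarrow> f ` carrier P \<subseteq> carrier L \<and>
     (\<forall>C. scott_closed L C \<longrightarrow> scott_closed P {x \<in> carrier P. f x \<in> C})"
  unfolding scott_continuous_def continuous_map_closedin topspace_scott_topology
    closedin_scott_topology by blast

text \<open>The preimage under \<open>f\<close> of the principal ideal of \<open>f y\<close> is
  Scott closed, hence a lower set, and it contains \<open>y\<close>; so it contains
  \<open>x\<close>.\<close>

lemma scott_continuous_mono:
  assumes L: "partial_order L" and f: "scott_continuous P L f"
    and "x \<in> carrier P" "y \<in> carrier P" "x \<sqsubseteq>\<^bsub>P\<^esub> y"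
  shows "f x \<sqsubseteq>\<^bsub>L\<^esub> f y"
proof -
  have fy: "f y \<in> carrier L" using f assms(4) unfolding scott_continuous_iff by blast
  have "scott_closed P {x \<in> carrier P. f x \<in> {z \<in> carrier L. z \<sqsubseteq>\<^bsub>L\<^esub> f y}}"
    using f scott_closed_principal[OF L fy] unfolding scott_continuous_iff by blast
  moreover have "y \<in> {x \<in> carrier P. f x \<in> {z \<in> carrier L. z \<sqsubseteq>\<^bsub>L\<^esub> f y}}"
    using assms(4) fy partial_order_refl[OF L] by blast
  ultimately have "x \<in> {x \<in> carrier P. f x \<in> {z \<in> carrier L. z \<sqsubseteq>\<^bsub>L\<^esub> f y}}"
    using assms(3,5) unfolding scott_closed_def by blast
  then show ?thesis by blast
qed

section \<open>Suprema of nonempty bounded sets in a dcpo-\<or>-semilattice with consistent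
  joins\<close>

text \<open>Elements are joined one at a time: \<open>u\<close> lies above the new element and, by
  leastness, above the supremum of the earlier ones, so each pair to be joined is consistent. The
  induction starts from singletons because \<open>L\<close> may lack a least element.\<close>

lemma finite_bounded_lub:
  assumes L: "dcpo_vee_semilattice L" and F: "finite F" "F \<noteq> {}" "F \<subseteq> carrier L"
    and u: "u \<in> carrier L" "\<forall>x\<in>F. x \<sqsubseteq>\<^bsub>L\<^esub> u"
  shows "\<exists>s. is_lub L s F"
  using F u
proof (induction F rule: finite_ne_induct)
  have po: "partial_order L" using L unfolding dcpo_vee_semilattice_def dcpo_def by blast
  {
    case (singleton x)
    then show ?case using is_lub_iff[of "{x}" L x] partial_order_refl[OF po] by auto
  next
    case (insert x F)
    then obtain s where "is_lub L s F" by blast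
    then have s: "s \<in> carrier L" "\<forall>x\<in>F. x \<sqsubseteq>\<^bsub>L\<^esub> s"
      "\<And>v. v \<in> carrier L \<Longrightarrow> \<forall>x\<in>F. x \<sqsubseteq>\<^bsub>L\<^esub> v \<Longrightarrow> s \<sqsubseteq>\<^bsub>L\<^esub> v"
      using is_lub_iff[of F L s] insert.prems by auto
    have x: "x \<in> carrier L" using insert.prems by blast
    have "consistent L {x, s}"
      using x s insert.prems unfolding consistent_iff by auto
    then obtain j where "is_lub L j {x, s}"
      using L x s(1) unfolding dcpo_vee_semilattice_def by blast
    then have j: "j \<in> carrier L" "x \<sqsubseteq>\<^bsub>L\<^esub> j" "s \<sqsubseteq>\<^bsub>L\<^esub> j"
      "\<And>v. v \<in> carrier L \<Longrightarrow> x \<sqsubseteq>\<^bsub>L\<^esub> v \<Longrightarrow> s \<sqsubseteq>\<^bsub>L\<^esub> v \<Longrightarrow> j \<sqsubseteq>\<^bsub>L\<^esub> v"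
      using is_lub_iff[of "{x, s}" L j] x s(1) by auto
    have "y \<sqsubseteq>\<^bsub>L\<^esub> j" if "y \<in> F" for y
      using partial_order_trans[OF po, of y s j] that s j insert.prems by blast
    then have "is_lub L j (insert x F)"
      using j s(3) insert.prems by (subst is_lub_iff) auto
    then show ?case by blast
  }
qed

text \<open>The suprema of the finite nonempty subsets form a directed set.\<close>

lemma bounded_lub:
  assumes L: "dcpo_vee_semilattice L" and S: "S \<noteq> {}" "S \<subseteq> carrier L"
    and u: "u \<in> carrier L" "\<forall>x\<in>S. x \<sqsubseteq>\<^bsub>L\<^esub> u"
  shows "\<exists>s. is_lub L s S"
proof -
  have po: "partial_order L" using L unfolding dcpo_vee_semilattice_def dcpo_def by blast
  define D where "D = {d. \<exists>F. finite F \<and> F \<noteq> {} \<and> F \<subseteq> S \<and> is_lub L d F}"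
  have D: "d \<in> carrier L" if "d \<in> D" for d
    using that unfolding D_def least_def by blast
  have SD: "S \<subseteq> D"
  proof
    fix x assume x: "x \<in> S"
    then have "is_lub L x {x}"
      using S partial_order_refl[OF po] by (subst is_lub_iff) auto
    then show "x \<in> D" unfolding D_def using x by blast
  qed
  have "directed_in L D"
    unfolding directed_in_def
  proof (intro conjI ballI)
    show "D \<subseteq> carrier L" using D by blast
    show "D \<noteq> {}" using SD S by blast
  next
    fix x y assume "x \<in> D" "y \<in> D"
    then obtain F G where F: "finite F" "F \<noteq> {}" "F \<subseteq> S" "is_lub L x F"
      and G: "finite G" "G \<noteq> {}" "G \<subseteq> S" "is_lub L y G" unfolding D_def by blast
    \<comment> \<open>The union is again finite and bounded by \<open>u\<close>; its supremum lies
      above those of \<open>F\<close> and \<open>G\<close>.\<close>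
    have "\<exists>z. is_lub L z (F \<union> G)"
      by (rule finite_bounded_lub[OF L _ _ _ u(1)]) (use F G S u in auto)
    then obtain z where z: "is_lub L z (F \<union> G)" by blast
    have "F \<union> G \<subseteq> S" using F(3) G(3) by blast
    then have "z \<in> D" unfolding D_def using z F(1,2) G(1) by blast
    moreover have "x \<sqsubseteq>\<^bsub>L\<^esub> z \<and> y \<sqsubseteq>\<^bsub>L\<^esub> z"
      using z F(4) G(4) \<open>F \<union> G \<subseteq> S\<close> S(2) is_lub_iff[of "F \<union> G" L z] is_lub_iff[of F L x]
        is_lub_iff[of G L y] by (meson UnCI le_sup_iff subset_trans)
    ultimately show "\<exists>z\<in>D. x \<sqsubseteq>\<^bsub>L\<^esub> z \<and> y \<sqsubseteq>\<^bsub>L\<^esub> z" by blast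
  qed
  then obtain s where "is_lub L s D"
    using L unfolding dcpo_vee_semilattice_def dcpo_def by blast
  then have s: "s \<in> carrier L" "\<forall>x\<in>D. x \<sqsubseteq>\<^bsub>L\<^esub> s"
    "\<And>v. v \<in> carrier L \<Longrightarrow> \<forall>x\<in>D. x \<sqsubseteq>\<^bsub>L\<^esub> v \<Longrightarrow> s \<sqsubseteq>\<^bsub>L\<^esub> v"
    using is_lub_iff[of D L s] D by auto
  \<comment> \<open>\<open>S\<close> and \<open>D\<close> have the same upper bounds, so the
    supremum of \<open>D\<close> is also that of \<open>S\<close>.\<close>
  have "d \<sqsubseteq>\<^bsub>L\<^esub> v" if v: "v \<in> carrier L" "\<forall>x\<in>S. x \<sqsubseteq>\<^bsub>L\<^esub> v" and d: "d \<in> D" for d v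
  proof -
    obtain F where "F \<subseteq> S" "is_lub L d F" using d unfolding D_def by blast
    then show ?thesis using v S(2) is_lub_iff[of F L d] by blast
  qed
  then have "is_lub L s S"
    using s SD S(2) by (subst is_lub_iff) auto
  then show ?thesis by blast
qed

section \<open>Members of the closure are \<Or>-existing\<close>

lemma Gamma_simps [simp]:
  "carrier (Gamma P) = {A. scott_closed P A \<and> A \<noteq> {}}"
  "A \<sqsubseteq>\<^bsub>Gamma P\<^esub> B \<longleftrightarrow> A \<subseteq> B"
  by (simp_all add: Gamma_def)

lemma Gamma_carrier_subset: "A \<in> carrier (Gamma P) \<Longrightarrow> A \<subseteq> carrier P"
  by (simp add: scott_closed_def)

lemma scott_closed_Int:
  assumes "scott_closed P A" "scott_closed P B"
  shows "scott_closed P (A \<inter> B)"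
  using closedin_Int[of "scott_topology P" A B] assms by (simp add: closedin_scott_topology)

text \<open>For the lower set property, a supremum of \<open>f\<close>
  A\<open>bounds the image of every subset of\<close>A\<open>. For a directed family\<close>D\<open>with supremum\<close>E\<open>, the suprema of the images form a directed set in\<close>L\<open>, and its supremum is that of\<close>f
  \<open>E\<close>.\<close>

lemma scott_closed_lubs_exist:
  assumes L: "dcpo_vee_semilattice L" and f: "scott_continuous P L f"
  shows "scott_closed (Gamma P) {A \<in> carrier (Gamma P). \<exists>s. is_lub L s (f ` A)}"
  unfolding scott_closed_def
proof (intro conjI ballI allI impI)
  have po: "partial_order L" using L unfolding dcpo_vee_semilattice_def dcpo_def by blast
  have fA: "f ` A \<subseteq> carrier L" if "A \<in> carrier (Gamma P)" for A
    using f Gamma_carrier_subset[OF that] unfolding scott_continuous_iff by blast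
  let ?B = "{A \<in> carrier (Gamma P). \<exists>s. is_lub L s (f ` A)}"
  {
    show "?B \<subseteq> carrier (Gamma P)" by blast
  next
    fix A B assume A: "A \<in> ?B" and B: "B \<in> carrier (Gamma P)" "B \<sqsubseteq>\<^bsub>Gamma P\<^esub> A"
    from A obtain s where "is_lub L s (f ` A)" by blast
    then have "s \<in> carrier L" "\<forall>x\<in>f ` A. x \<sqsubseteq>\<^bsub>L\<^esub> s"
      using is_lub_iff[of "f ` A" L s] fA A by auto
    then have "\<exists>s. is_lub L s (f ` B)"
      using B by (intro bounded_lub[OF L _ fA[OF B(1)], of s]) auto
    then show "B \<in> ?B" using B by blast
  next
    fix D E assume "directed_in (Gamma P) D \<and> D \<subseteq> ?B \<and> is_lub (Gamma P) E D"
    then have D: "directed_in (Gamma P) D" "D \<subseteq> ?B" "is_lub (Gamma P) E D" by auto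
    have DG: "D \<subseteq> carrier (Gamma P)" using D(2) by blast
    have E: "E \<in> carrier (Gamma P)" "\<And>A. A \<in> D \<Longrightarrow> A \<subseteq> E"
      "\<And>G. G \<in> carrier (Gamma P) \<Longrightarrow> \<forall>A\<in>D. A \<subseteq> G \<Longrightarrow> E \<subseteq> G"
      using D(3) is_lub_iff[OF DG, of E] by auto
    have "\<forall>A\<in>D. \<exists>s. is_lub L s (f ` A)" using D(2) by blast
    then obtain t where t_lub: "\<forall>A\<in>D. is_lub L (t A) (f ` A)"
      using bchoice[of D "\<lambda>A s. is_lub L s (f ` A)"] by blast
    have t: "t A \<in> carrier L" "\<forall>x\<in>A. f x \<sqsubseteq>\<^bsub>L\<^esub> t A"
      "\<And>v. v \<in> carrier L \<Longrightarrow> \<forall>x\<in>A. f x \<sqsubseteq>\<^bsub>L\<^esub> v \<Longrightarrow> t A \<sqsubseteq>\<^bsub>L\<^esub> v" if "A \<in> D" for A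
    proof -
      have "f ` A \<subseteq> carrier L" using that DG fA by blast
      then show "t A \<in> carrier L" "\<forall>x\<in>A. f x \<sqsubseteq>\<^bsub>L\<^esub> t A"
        "\<And>v. v \<in> carrier L \<Longrightarrow> \<forall>x\<in>A. f x \<sqsubseteq>\<^bsub>L\<^esub> v \<Longrightarrow> t A \<sqsubseteq>\<^bsub>L\<^esub> v"
        using bspec[OF t_lub that] is_lub_iff[of "f ` A" L "t A"] by auto
    qed
    have tD: "t ` D \<subseteq> carrier L" using t(1) by blast
    have t_mono: "t A \<sqsubseteq>\<^bsub>L\<^esub> t B" if "A \<in> D" "B \<in> D" "A \<subseteq> B" for A B
      using t[OF that(1)] t[OF that(2)] that(3) by blast
    \<comment> \<open>Since \<open>t\<close> is monotone for inclusion, it carries the directedness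
      of \<open>D\<close> over to \<open>L\<close>.\<close>
    have "directed_in L (t ` D)"
      unfolding directed_in_def
    proof (intro conjI ballI)
      show "t ` D \<noteq> {}" using D(1) unfolding directed_in_def by blast
    next
      fix x y assume "x \<in> t ` D" "y \<in> t ` D"
      then obtain A B where AB: "A \<in> D" "B \<in> D" "x = t A" "y = t B" by blast
      then obtain C where C: "C \<in> D" "A \<subseteq> C" "B \<subseteq> C"
        using D(1) unfolding directed_in_def Gamma_simps by blast
      then have "x \<sqsubseteq>\<^bsub>L\<^esub> t C" "y \<sqsubseteq>\<^bsub>L\<^esub> t C"
        using AB t_mono by auto
      then show "\<exists>z\<in>t ` D. x \<sqsubseteq>\<^bsub>L\<^esub> z \<and> y \<sqsubseteq>\<^bsub>L\<^esub> z" using C(1) by blast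
    qed (rule tD)
    then obtain s where "is_lub L s (t ` D)"
      using L unfolding dcpo_vee_semilattice_def dcpo_def by blast
    then have s: "s \<in> carrier L" "\<forall>A\<in>D. t A \<sqsubseteq>\<^bsub>L\<^esub> s"
      "\<And>v. v \<in> carrier L \<Longrightarrow> \<forall>A\<in>D. t A \<sqsubseteq>\<^bsub>L\<^esub> v \<Longrightarrow> s \<sqsubseteq>\<^bsub>L\<^esub> v"
      using is_lub_iff[OF tD, of s] by auto
    define G where "G = E \<inter> {x \<in> carrier P. f x \<in> {z \<in> carrier L. z \<sqsubseteq>\<^bsub>L\<^esub> s}}"
    have "scott_closed P {x \<in> carrier P. f x \<in> {z \<in> carrier L. z \<sqsubseteq>\<^bsub>L\<^esub> s}}"
      using f scott_closed_principal[OF po s(1)] unfolding scott_continuous_iff by blast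
    then have "scott_closed P G"
      unfolding G_def using E(1) by (intro scott_closed_Int) auto
    have DsubG: "A \<subseteq> G" if A: "A \<in> D" for A
    proof
      fix x assume x: "x \<in> A"
      have "A \<in> carrier (Gamma P)" using A DG by blast
      then have "x \<in> carrier P" "f x \<in> carrier L"
        using x fA[of A] Gamma_carrier_subset[of A P] by blast+
      moreover have "f x \<sqsubseteq>\<^bsub>L\<^esub> s"
        using partial_order_trans[OF po, of "f x" "t A" s] t(1,2)[OF A] s(1,2) A x \<open>f x \<in> carrier L\<close>
        by blast
      ultimately show "x \<in> G" using x A E(2) unfolding G_def by blast
    qed
    \<comment> \<open>Leastness of \<open>E\<close> applies only to members of
      \<open>Gamma P\<close>, so \<open>G\<close> must be shown nonempty.\<close>
    obtain A where "A \<in> D" using D(1) unfolding directed_in_def by blast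
    then have "G \<noteq> {}" using DsubG DG by fastforce
    then have "E \<subseteq> G" using E(3) DsubG \<open>scott_closed P G\<close> by simp
    then have le: "\<forall>x\<in>E. f x \<sqsubseteq>\<^bsub>L\<^esub> s" unfolding G_def by blast
    \<comment> \<open>A bound of \<open>f\<close> E\<open>bounds\<close>f \<open>A\<close> for each
      \<open>A\<close> in \<open>D\<close>, hence every \<open>t A\<close>, hence
      \<open>s\<close>.\<close>
    have "s \<sqsubseteq>\<^bsub>L\<^esub> v" if v: "v \<in> carrier L" "\<forall>x\<in>E. f x \<sqsubseteq>\<^bsub>L\<^esub> v" for v
      using s(3)[OF v(1)] t(3)[OF _ v(1)] v(2) E(2) by blast
    then have "is_lub L s (f ` E)"
      using le s(1) fA[OF E(1)] by (subst is_lub_iff) auto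
    then show "E \<in> ?B" using E(1) by blast
  }
qed

lemma closure_Gamma_c_vee_existing:
  fixes P :: "'a gorder"
  assumes A: "A \<in> scott_topology (Gamma P) closure_of Gamma_c P"
  shows "vee_existing TYPE('b) P A"
  unfolding vee_existing_def
proof (intro conjI allI impI)
  have "A \<in> carrier (Gamma P)"
    using A by (metis in_closure_of topspace_scott_topology)
  then show "A \<subseteq> carrier P" by (simp add: scott_closed_def)
next
  fix L :: "'b gorder" and f
  assume "dcpo_vee_semilattice L \<and> scott_continuous P L f"
  then have L: "dcpo_vee_semilattice L" and f: "scott_continuous P L f" by auto
  have po: "partial_order L" using L unfolding dcpo_vee_semilattice_def dcpo_def by blast
  have "Gamma_c P \<subseteq> {A \<in> carrier (Gamma P). \<exists>s. is_lub L s (f ` A)}"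
  proof
    fix B assume "B \<in> Gamma_c P"
    then obtain u where B: "B \<in> carrier (Gamma P)" "B \<subseteq> carrier P"
      and u: "u \<in> carrier P" "\<forall>x\<in>B. x \<sqsubseteq>\<^bsub>P\<^esub> u"
      unfolding Gamma_c_def consistent_iff by blast
    have fP: "f ` carrier P \<subseteq> carrier L" using f unfolding scott_continuous_iff by blast
    \<comment> \<open>By monotonicity \<open>f u\<close> bounds the image of the consistent set
      \<open>B\<close>.\<close>
    have "\<exists>s. is_lub L s (f ` B)"
      by (rule bounded_lub[OF L, of _ "f u"])
        (use B u fP scott_continuous_mono[OF po f] in auto)
    then show "B \<in> {A \<in> carrier (Gamma P). \<exists>s. is_lub L s (f ` A)}" using B by blast
  qed
  then have "scott_topology (Gamma P) closure_of Gamma_c P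
      \<subseteq> {A \<in> carrier (Gamma P). \<exists>s. is_lub L s (f ` A)}"
    using scott_closed_lubs_exist[OF L f]
    by (intro closure_of_minimal) (simp_all only: closedin_scott_topology)
  then show "\<exists>s. is_lub L s (f ` A)" using A by blast
qed

section \<open>\<open>Gamma P\<close> and its Scott closed subsets as test semilattices\<close>

text \<open>A directed family has the Scott closure of its union as supremum, and two members have
  their union as join, because a union of two Scott closed sets is Scott closed.\<close>

lemma dcpo_vee_semilattice_Gamma: "dcpo_vee_semilattice (Gamma P)"
  unfolding dcpo_vee_semilattice_def dcpo_def
proof (intro conjI allI impI ballI)
  show "partial_order (Gamma P)" by (rule partial_order_Gamma)
next
  fix D assume D: "directed_in (Gamma P) D"
  then have DG: "D \<subseteq> carrier (Gamma P)" "D \<noteq> {}" unfolding directed_in_def by auto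
  let ?E = "scott_topology P closure_of \<Union>D"
  have DP: "\<Union>D \<subseteq> topspace (scott_topology P)"
    using DG by (auto simp: scott_closed_def topspace_scott_topology)
  have E: "scott_closed P ?E"
    using closedin_closure_of[of "scott_topology P" "\<Union>D"] by (simp only: closedin_scott_topology)
  have DE: "\<Union>D \<subseteq> ?E" using DP by (rule closure_of_subset)
  have "?E \<noteq> {}" using DG DE by fastforce
  moreover have "?E \<subseteq> G" if "scott_closed P G" "\<forall>A\<in>D. A \<subseteq> G" for G
    by (rule closure_of_minimal) (use that in \<open>auto simp: closedin_scott_topology\<close>)
  ultimately have "is_lub (Gamma P) ?E D"
    using E DE DG(1) by (subst is_lub_iff) auto
  then show "\<exists>s. is_lub (Gamma P) s D" by blast
next
  fix A B assume "A \<in> carrier (Gamma P)" "B \<in> carrier (Gamma P)"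
  then have "is_lub (Gamma P) (A \<union> B) {A, B}"
    by (subst is_lub_iff) (auto simp: scott_closed_Un)
  then show "\<exists>j. is_lub (Gamma P) j {A, B}" by blast
qed

text \<open>Shrinking the carrier only removes upper bounds, so \<open>s\<close> stays least as long
  as it is kept.\<close>

lemma is_lub_restrict:
  assumes "C \<subseteq> carrier Q" "S \<subseteq> C" "s \<in> C" "is_lub Q s S"
  shows "is_lub (Q\<lparr>carrier := C\<rparr>) s S"
  using assms is_lub_iff[of S Q s] by (subst is_lub_iff) auto

text \<open>Suprema formed in \<open>Q\<close> stay in \<open>C\<close>: directed ones by
  closedness, and the join of a consistent pair because it lies below a bound in the lower set
  \<open>C\<close>.\<close>

lemma dcpo_vee_semilattice_scott_closed:
  fixes Q :: "'a gorder"
  assumes Q: "dcpo_vee_semilattice Q" and C: "scott_closed Q C"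
  shows "dcpo_vee_semilattice (Q\<lparr>carrier := C\<rparr>)"
  unfolding dcpo_vee_semilattice_def dcpo_def
proof (intro conjI allI impI ballI)
  have CQ: "C \<subseteq> carrier Q" using C unfolding scott_closed_def by blast
  have po: "partial_order Q" using Q unfolding dcpo_vee_semilattice_def dcpo_def by blast
  {
    interpret Q: partial_order Q by (rule po)
    show "partial_order (Q\<lparr>carrier := C\<rparr>)"
    proof
      fix x y z
      assume "x \<sqsubseteq>\<^bsub>Q\<lparr>carrier := C\<rparr>\<^esub> y" "y \<sqsubseteq>\<^bsub>Q\<lparr>carrier := C\<rparr>\<^esub> z"
        "x \<in> carrier (Q\<lparr>carrier := C\<rparr>)" "y \<in> carrier (Q\<lparr>carrier := C\<rparr>)"
        "z \<in> carrier (Q\<lparr>carrier := C\<rparr>)"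
      then show "x \<sqsubseteq>\<^bsub>Q\<lparr>carrier := C\<rparr>\<^esub> z"
        using partial_order_trans[OF po, of x y z] CQ by auto
    qed (use CQ Q.eq_is_equal in \<open>auto intro: Q.le_antisym\<close>)
  next
    fix D assume "directed_in (Q\<lparr>carrier := C\<rparr>) D"
    then have D: "directed_in Q D" "D \<subseteq> C" using CQ unfolding directed_in_def by auto
    then obtain s where s: "is_lub Q s D"
      using Q unfolding dcpo_vee_semilattice_def dcpo_def by blast
    then have "s \<in> C" using C D unfolding scott_closed_def by blast
    then show "\<exists>s. is_lub (Q\<lparr>carrier := C\<rparr>) s D"
      using is_lub_restrict[OF CQ D(2) _ s] by blast
  next
    fix x y assume "x \<in> carrier (Q\<lparr>carrier := C\<rparr>)" "y \<in> carrier (Q\<lparr>carrier := C\<rparr>)"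
      and cons: "consistent (Q\<lparr>carrier := C\<rparr>) {x, y}"
    then have xy: "x \<in> C" "y \<in> C" by auto
    \<comment> \<open>Consistency in the restricted order provides a bound inside \<open>C\<close>,
      not merely in \<open>Q\<close>.\<close>
    obtain u where u: "u \<in> C" "x \<sqsubseteq>\<^bsub>Q\<^esub> u" "y \<sqsubseteq>\<^bsub>Q\<^esub> u"
      using cons unfolding consistent_iff by auto
    then have "consistent Q {x, y}" using xy CQ unfolding consistent_iff by blast
    then obtain j where j: "is_lub Q j {x, y}"
      using Q xy CQ unfolding dcpo_vee_semilattice_def by blast
    then have "j \<sqsubseteq>\<^bsub>Q\<^esub> u" "j \<in> carrier Q"
      using is_lub_iff[of "{x, y}" Q j] xy u CQ by auto
    then have "j \<in> C" using C u(1) unfolding scott_closed_def by blast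
    then show "\<exists>j. is_lub (Q\<lparr>carrier := C\<rparr>) j {x, y}"
      using is_lub_restrict[OF CQ _ _ j] xy by blast
  }
qed

section \<open>The principal ideal embedding and the converse inclusion\<close>

text \<open>The embedding preserves directed suprema: a member of \<open>C\<close> containing the
  principal ideals of all elements of \<open>D\<close> contains \<open>D\<close>, hence
  \<open>s\<close> by Scott closedness in \<open>P\<close>, hence everything below \<open>s\<close>.
  So preimages of Scott closed sets are closed under directed suprema.\<close>

lemma scott_continuous_principal:
  assumes P: "partial_order P" and C: "C \<subseteq> carrier (Gamma P)"
    and PC: "\<And>x. x \<in> carrier P \<Longrightarrow> {z \<in> carrier P. z \<sqsubseteq>\<^bsub>P\<^esub> x} \<in> C"
  shows "scott_continuous P ((Gamma P)\<lparr>carrier := C\<rparr>) (\<lambda>x. {z \<in> carrier P. z \<sqsubseteq>\<^bsub>P\<^esub> x})"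
    (is "scott_continuous P ?L ?d")
  unfolding scott_continuous_iff
proof (intro conjI allI impI)
  show "?d ` carrier P \<subseteq> carrier ?L" using PC by auto
next
  have mono: "?d x \<subseteq> ?d y" if "x \<in> carrier P" "y \<in> carrier P" "x \<sqsubseteq>\<^bsub>P\<^esub> y" for x y
    using partial_order_trans[OF P] that by blast
  have self: "x \<in> ?d x" if "x \<in> carrier P" for x
    using partial_order_refl[OF P] that by blast
  fix E assume E: "scott_closed ?L E"
  show "scott_closed P {x \<in> carrier P. ?d x \<in> E}"
    unfolding scott_closed_def
  proof (intro conjI ballI allI impI)
    show "{x \<in> carrier P. ?d x \<in> E} \<subseteq> carrier P" by blast
  next
    fix x y assume x: "x \<in> {x \<in> carrier P. ?d x \<in> E}" and y: "y \<in> carrier P" "y \<sqsubseteq>\<^bsub>P\<^esub> x"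
    have "?d y \<in> carrier ?L" "?d y \<sqsubseteq>\<^bsub>?L\<^esub> ?d x" using PC mono x y by auto
    then have "?d y \<in> E" using E x unfolding scott_closed_def by blast
    then show "y \<in> {x \<in> carrier P. ?d x \<in> E}" using y by blast
  next
    fix D s assume "directed_in P D \<and> D \<subseteq> {x \<in> carrier P. ?d x \<in> E} \<and> is_lub P s D"
    then have D: "directed_in P D" "D \<subseteq> {x \<in> carrier P. ?d x \<in> E}" "is_lub P s D" by auto
    have DP: "D \<subseteq> carrier P" using D(2) by blast
    have s: "s \<in> carrier P" "\<And>x. x \<in> D \<Longrightarrow> x \<sqsubseteq>\<^bsub>P\<^esub> s"
      using D(3) is_lub_iff[OF DP, of s] by auto
    have "directed_in ?L (?d ` D)"
      unfolding directed_in_def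
    proof (intro conjI ballI)
      show "?d ` D \<subseteq> carrier ?L" using PC DP by auto
      show "?d ` D \<noteq> {}" using D(1) unfolding directed_in_def by blast
    next
      fix X Y assume "X \<in> ?d ` D" "Y \<in> ?d ` D"
      then obtain x y where xy: "x \<in> D" "y \<in> D" "X = ?d x" "Y = ?d y" by blast
      then obtain z where z: "z \<in> D" "x \<sqsubseteq>\<^bsub>P\<^esub> z" "y \<sqsubseteq>\<^bsub>P\<^esub> z"
        using D(1) unfolding directed_in_def by blast
      have "X \<subseteq> ?d z" "Y \<subseteq> ?d z" using mono[of x z] mono[of y z] xy z DP by auto
      then show "\<exists>Z\<in>?d ` D. X \<sqsubseteq>\<^bsub>?L\<^esub> Z \<and> Y \<sqsubseteq>\<^bsub>?L\<^esub> Z" using z(1) by auto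
    qed
    moreover have "is_lub ?L (?d s) (?d ` D)"
    proof (subst is_lub_iff)
      show "?d ` D \<subseteq> carrier ?L" using PC DP by auto
      have "?d s \<subseteq> B" if B: "B \<in> C" "\<forall>X\<in>?d ` D. X \<subseteq> B" for B
      proof -
        have "scott_closed P B" using B(1) C by auto
        moreover have "D \<subseteq> B"
        proof
          fix x assume x: "x \<in> D"
          then have "?d x \<subseteq> B" by (intro bspec[OF B(2)] imageI)
          then show "x \<in> B" using self[of x] x DP by (meson subsetD)
        qed
        ultimately have "s \<in> B" using D(1,3) unfolding scott_closed_def by blast
        then show ?thesis using \<open>scott_closed P B\<close> unfolding scott_closed_def by blast
      qed
      moreover have "?d x \<subseteq> ?d s" if "x \<in> D" for x
        using mono that s DP by blast
      ultimately show "?d s \<in> carrier ?L \<and> (\<forall>x\<in>?d ` D. x \<sqsubseteq>\<^bsub>?L\<^esub> ?d s) \<and>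
          (\<forall>u\<in>carrier ?L. (\<forall>x\<in>?d ` D. x \<sqsubseteq>\<^bsub>?L\<^esub> u) \<longrightarrow> ?d s \<sqsubseteq>\<^bsub>?L\<^esub> u)"
        using PC[OF s(1)] by simp
    qed
    moreover have "?d ` D \<subseteq> E" using D(2) by blast
    ultimately have "?d s \<in> E" using E unfolding scott_closed_def by blast
    then show "s \<in> {x \<in> carrier P. ?d x \<in> E}" using s(1) by blast
  qed
qed

text \<open>The empty set has no supremum in a two-element antichain.\<close>

lemma vee_existing_nonempty:
  fixes P :: "'a gorder" and x y :: 'b
  assumes A: "vee_existing TYPE('b) P A" and "x \<noteq> y"
  shows "A \<noteq> {}"
proof
  assume "A = {}"
  define L :: "'b gorder" where "L = \<lparr>carrier = {x, y}, eq = (=), le = (=)\<rparr>"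
  have L_simps [simp]: "carrier L = {x, y}" "\<And>a b. a \<sqsubseteq>\<^bsub>L\<^esub> b \<longleftrightarrow> a = b"
    by (simp_all add: L_def)
  have "partial_order L"
    by unfold_locales (simp_all add: L_def)
  moreover have "\<exists>s. is_lub L s D" if D: "directed_in L D" for D
  proof -
    obtain d where "d \<in> D" using D unfolding directed_in_def by blast
    \<comment> \<open>In an antichain directedness makes all elements of \<open>D\<close> equal to
      \<open>d\<close>.\<close>
    then have "is_lub L d D" using D unfolding directed_in_def
      by (subst is_lub_iff) auto
    then show ?thesis by blast
  qed
  moreover have "\<exists>j. is_lub L j {a, b}" if "consistent L {a, b}" for a b
  proof -
    have "a = b" "a \<in> carrier L" using that unfolding consistent_iff by auto
    then have "is_lub L a {a, b}" by (subst is_lub_iff) auto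
    then show ?thesis by blast
  qed
  ultimately have "dcpo_vee_semilattice L" unfolding dcpo_vee_semilattice_def dcpo_def by blast
  moreover have "scott_continuous P L (\<lambda>_. x)"
    unfolding scott_continuous_def
    by (simp add: topspace_scott_topology)
  ultimately have "\<exists>s. is_lub L s ((\<lambda>_. x) ` A)"
    using A unfolding vee_existing_def by blast
  then obtain s where "is_lub L s {}" using \<open>A = {}\<close> by auto
  \<comment> \<open>A supremum of the empty set would be a least element of
    \<open>L\<close>.\<close>
  then show False using \<open>x \<noteq> y\<close> is_lub_iff[of "{}" L s] by auto
qed

text \<open>The test semilattice is the closure itself. Its elements are subsets of
  \<open>P\<close>, which is why \<Or>-existence is assumed at the type
  \<open>'a set\<close>.\<close>

lemma vee_existing_in_closure_Gamma_c:
  fixes P :: "'a gorder"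
  assumes P: "partial_order P" and A: "scott_closed P A" "vee_existing TYPE('a set) P A"
  shows "A \<in> scott_topology (Gamma P) closure_of Gamma_c P"
proof -
  let ?C = "scott_topology (Gamma P) closure_of Gamma_c P"
  let ?L = "(Gamma P)\<lparr>carrier := ?C\<rparr>"
  let ?d = "\<lambda>x. {z \<in> carrier P. z \<sqsubseteq>\<^bsub>P\<^esub> x}"
  have C: "scott_closed (Gamma P) ?C"
    using closedin_closure_of by (simp only: closedin_scott_topology[symmetric])
  then have CG: "?C \<subseteq> carrier (Gamma P)" unfolding scott_closed_def by blast
  have self: "x \<in> ?d x" if "x \<in> carrier P" for x
    using partial_order_refl[OF P] that by blast
  have sub: "Gamma_c P \<subseteq> ?C"
    by (rule closure_of_subset) (auto simp: Gamma_c_def topspace_scott_topology)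
  have dC: "?d x \<in> ?C" if x: "x \<in> carrier P" for x
  proof -
    \<comment> \<open>A principal ideal is bounded by its generator, so it belongs to
      \<open>Gamma_c P\<close>.\<close>
    have "consistent P (?d x)" using x unfolding consistent_iff by blast
    moreover have "?d x \<noteq> {}" using self[OF x] by blast
    ultimately have "?d x \<in> Gamma_c P"
      using scott_closed_principal[OF P x] unfolding Gamma_c_def by simp
    then show ?thesis using sub by blast
  qed
  have "dcpo_vee_semilattice ?L"
    by (rule dcpo_vee_semilattice_scott_closed[OF dcpo_vee_semilattice_Gamma C])
  moreover have "scott_continuous P ?L ?d"
    using scott_continuous_principal[OF P CG dC] .
  ultimately obtain S where S: "is_lub ?L S (?d ` A)"
    using A(2) unfolding vee_existing_def by blast
  have AP: "A \<subseteq> carrier P" using A(1) unfolding scott_closed_def by blast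
  then have "?d ` A \<subseteq> carrier ?L" using dC by auto
  then have S': "S \<in> ?C" "\<And>x. x \<in> A \<Longrightarrow> ?d x \<subseteq> S"
    using S is_lub_iff[of "?d ` A" ?L S] by auto
  have "A \<subseteq> S" using S'(2) self AP by blast
  \<comment> \<open>Being a lower set in \<open>Gamma P\<close>, the closure contains the nonempty
    Scott closed subsets of its member \<open>S\<close>. The type \<open>'a set\<close> has the two
    distinct elements \<open>{}\<close> and \<open>UNIV\<close> for the antichain.\<close>
  moreover have "A \<noteq> {}"
    using vee_existing_nonempty[OF A(2), of "{}" UNIV] by blast
  ultimately show ?thesis
    using C S'(1) A(1) unfolding scott_closed_def[of "Gamma P"] by simp
qed

text \<open>The converse inclusion tests \<open>A\<close> only against the closure and a two-element
  antichain, both realised on \<open>'a set\<close>, so the equality is stated at that type. The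
  inclusion at an arbitrary type \<open>'b\<close> then shows that being \<Or>-existing at
  \<open>'a set\<close> carries over to test semilattices on any type, for Scott closed
  sets.\<close>

theorem theorem3p9:
  fixes P :: "'a gorder" and A :: "'a set"
  assumes "dcpo P" and "A \<subseteq> carrier P"
  shows "(A \<in> scott_topology (Gamma P) closure_of Gamma_c P \<longleftrightarrow>
            scott_closed P A \<and> vee_existing TYPE('a set) P A) \<and>
         scott_topology (Gamma P) closure_of Gamma_c P = vee_completion TYPE('a set) P \<and>
         scott_topology (Gamma P) closure_of Gamma_c P \<subseteq> vee_completion TYPE('b) P"
proof -
  let ?C = "scott_topology (Gamma P) closure_of Gamma_c P"
  have po: "partial_order P" using assms(1) unfolding dcpo_def by blast
  have closed: "scott_closed P B" if "B \<in> ?C" for B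
  proof -
    have "B \<in> carrier (Gamma P)" using that by (metis in_closure_of topspace_scott_topology)
    then show ?thesis by simp
  qed
  have "B \<in> ?C \<longleftrightarrow> scott_closed P B \<and> vee_existing TYPE('a set) P B" for B
    using closed closure_Gamma_c_vee_existing vee_existing_in_closure_Gamma_c[OF po] by blast
  moreover have "?C \<subseteq> vee_completion TYPE('b) P"
    unfolding vee_completion_def using closed closure_Gamma_c_vee_existing by blast
  ultimately show ?thesis unfolding vee_completion_def by blast
qed

end
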